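(* Let $m$ be a positive integer and $n = 4m$. Then $p_n \le 2 - \frac{1}{2^{m+3}-7}$. Equivalently: for every choice of real numbers $a_1,\dots,a_n \in [0,1]$ there exist signs $e_1,\dots,e_n \in \{-1,+1\}$ such that, with $s_0=0$ and $s_i=\sum_{k=1}^i e_k a_k$ for $1\le i\le n$, we have $\max_{0\le k\le n} s_k - \min_{0\le k\le n} s_k \le 2 - \frac{1}{2^{m+3}-7}$.
   Context: For a positive integer $n$, signs $e_1,\dots,e_n\in\{-1,+1\}$ and reals $a_1,\dots,a_n\in[0,1]$, set $s_0=0$ and $s_i=\sum_{k=1}^i e_k a_k$ for $1\le i\le n$. The range is $g(e_1,\dots,e_n,a_1,\dots,a_n)=\max_{0\le k\le n}s_k-\min_{0\le k\le n}s_k$. The step-cover is $f(a_1,\dots,a_n)=\min_{e_1,\dots,e_n\in\{-1,+1\}} g(e_1,\dots,e_n,a_1,\dots,a_n)$. The fit is $p_n=\max_{a_1,\dots,a_n\in[0,1]} f(a_1,\dots,a_n)$. *)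

theory Defs
  imports "HOL-Analysis.Analysis"
begin

definition signed_sum :: "(nat \<Rightarrow> real) \<Rightarrow> (nat \<Rightarrow> real) \<Rightarrow> nat \<Rightarrow> real" where
  "signed_sum e a i = (\<Sum>k=1..i. e k * a k)"

definition walk_range :: "nat \<Rightarrow> (nat \<Rightarrow> real) \<Rightarrow> (nat \<Rightarrow> real) \<Rightarrow> real" where
  "walk_range n e a = Max (signed_sum e a ` {0..n}) - Min (signed_sum e a ` {0..n})"

definition step_cover :: "nat \<Rightarrow> (nat \<Rightarrow> real) \<Rightarrow> real" where
  "step_cover n a = Min ((\<lambda>e. walk_range n e a) ` ({1..n} \<rightarrow>\<^sub>E {-1, 1}))"

text \<open>The supremum below is a maximum: see \<open>fit_attained\<close> and \<open>step_cover_le_fit\<close>.\<close>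

definition fit :: "nat \<Rightarrow> real" where
  "fit n = (SUP a\<in>{1..n} \<rightarrow>\<^sub>E {0..1}. step_cover n a)"

lemma continuous_on_Max_image:
  fixes f :: "'i \<Rightarrow> 'a::topological_space \<Rightarrow> real"
  assumes "finite I" "I \<noteq> {}" "\<And>i. i \<in> I \<Longrightarrow> continuous_on S (f i)"
  shows "continuous_on S (\<lambda>x. Max ((\<lambda>i. f i x) ` I))"
  using assms
proof (induction I rule: finite_ne_induct)
  case (insert i I)
  then show ?case by (simp add: continuous_on_max)
qed simp

lemma continuous_on_Min_image:
  fixes f :: "'i \<Rightarrow> 'a::topological_space \<Rightarrow> real"
  assumes "finite I" "I \<noteq> {}" "\<And>i. i \<in> I \<Longrightarrow> continuous_on S (f i)"
  shows "continuous_on S (\<lambda>x. Min ((\<lambda>i. f i x) ` I))"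
  using assms
proof (induction I rule: finite_ne_induct)
  case (insert i I)
  then show ?case by (simp add: continuous_on_min)
qed simp

lemma finite_signs: "finite ({1..n::nat} \<rightarrow>\<^sub>E {-1, 1::real})"
  by (intro finite_PiE) auto

lemma signs_nonempty: "({1..n::nat} \<rightarrow>\<^sub>E {-1, 1::real}) \<noteq> {}"
  by (simp add: PiE_eq_empty_iff)

lemma continuous_on_step_cover: "continuous_on S (step_cover n)"
proof -
  have "continuous_on S (\<lambda>a. walk_range n e a)" for e
    unfolding walk_range_def signed_sum_def
    by (intro continuous_on_diff continuous_on_Max_image continuous_on_Min_image
        continuous_on_sum continuous_on_mult_left
        continuous_on_subset[OF continuous_on_product_coordinates]) auto
  then have "continuous_on S (\<lambda>a. step_cover n a)"
    unfolding step_cover_def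
    by (intro continuous_on_Min_image finite_signs signs_nonempty) auto
  then show ?thesis by simp
qed

lemma compact_steps: "compact ({1..n::nat} \<rightarrow>\<^sub>E {0..1::real})"
proof -
  have eq: "({1..n} \<rightarrow>\<^sub>E {0..1}) =
      (\<Pi>\<^sub>E k\<in>UNIV. if k \<in> {1..n} then {0..1} else {undefined :: real})"
    by (auto simp: PiE_def Pi_def extensional_def split: if_splits)
  have "compactin (product_topology (\<lambda>_. euclidean) UNIV)
      (\<Pi>\<^sub>E k\<in>UNIV. if k \<in> {1..n} then {0..1} else {undefined :: real})"
    by (subst compactin_PiE) auto
  then show ?thesis
    unfolding eq by (simp add: euclidean_product_topology)
qed

lemma fit_attained: "\<exists>a\<in>{1..n} \<rightarrow>\<^sub>E {0..1}. step_cover n a = fit n"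
  and step_cover_le_fit: "a \<in> {1..n} \<rightarrow>\<^sub>E {0..1} \<Longrightarrow> step_cover n a \<le> fit n"
proof -
  have "({1..n::nat} \<rightarrow>\<^sub>E {0..1::real}) \<noteq> {}"
    by (simp add: PiE_eq_empty_iff)
  then obtain b where b: "b \<in> {1..n} \<rightarrow>\<^sub>E {0..1}"
    and max: "\<And>a. a \<in> {1..n} \<rightarrow>\<^sub>E {0..1} \<Longrightarrow> step_cover n a \<le> step_cover n b"
    using continuous_attains_sup[OF compact_steps _ continuous_on_step_cover] by metis
  then have "fit n = step_cover n b"
    unfolding fit_def by (intro cSup_eq_maximum) auto
  then show "\<exists>a\<in>{1..n} \<rightarrow>\<^sub>E {0..1}. step_cover n a = fit n"
    and "a \<in> {1..n} \<rightarrow>\<^sub>E {0..1} \<Longrightarrow> step_cover n a \<le> fit n"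
    using b max by auto
qed

end

theory Submission
  imports Defs
begin

text \<open>
  Put \<open>L = 2 - \<delta>\<close> and look for a walk inside \<open>{0..L}\<close> with a free starting point. Walks can be
  traversed backwards, so it suffices to find a point from which both the second half of the steps
  and the reversed first half can be carried out; such a point exists if for each half the set
  of trapped starting points has measure less than \<open>L/2\<close>.

  The trapped set grows slowly when steps are prepended in pairs. A step longer than \<open>L/2\<close>
  adds at most \<open>\<delta>\<close> to its measure, and a step of length at most \<open>L/2\<close> at most doubles it.
  The point is that two consecutive steps of length at most \<open>L/2\<close> still only double it: their
  signs can be chosen, depending on the starting point, such that the map from starting points to
  end points is at most two-to-one.
  Hence \<open>2k\<close> steps trap a set of measure at most \<open>(2 ^ (k + 1) - 2) * \<delta>\<close>.
\<close>

section \<open>Confined walks and trapped starting points\<close>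

definition confined_walk :: "real \<Rightarrow> nat \<Rightarrow> (nat \<Rightarrow> real) \<Rightarrow> (nat \<Rightarrow> real) \<Rightarrow> bool" where
  "confined_walk L n a p \<longleftrightarrow>
     (\<forall>k\<le>n. p k \<in> {0..L}) \<and> (\<forall>k<n. \<bar>p (Suc k) - p k\<bar> = a k)"

definition trapped :: "real \<Rightarrow> nat \<Rightarrow> (nat \<Rightarrow> real) \<Rightarrow> real set" where
  "trapped L n a = {x \<in> {0..L}. \<nexists>p. p 0 = x \<and> confined_walk L n a p}"

text \<open>A point with no move of length \<open>a\<close> inside \<open>{0..L}\<close> is forced
  vacuously; this is how a step longer than \<open>L / 2\<close> creates new trapped points.\<close>

definition forced :: "real \<Rightarrow> real \<Rightarrow> real set \<Rightarrow> real set" where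
  "forced L a B = {x \<in> {0..L}. \<forall>y\<in>{0..L}. \<bar>y - x\<bar> = a \<longrightarrow> y \<in> B}"

text \<open>An outer measure bound, which avoids showing that trapped sets are measurable.\<close>

definition coverable :: "real set \<Rightarrow> real \<Rightarrow> bool" where
  "coverable B c \<longleftrightarrow> (\<exists>V\<in>lmeasurable. B \<subseteq> V \<and> measure lebesgue V \<le> c)"

lemma trapped_0: "trapped L 0 a = {}"
  by (auto simp: trapped_def confined_walk_def)

lemma confined_walk_Cons:
  assumes "confined_walk L n (\<lambda>k. a (Suc k)) q" "x \<in> {0..L}" "\<bar>q 0 - x\<bar> = a 0"
  shows "confined_walk L (Suc n) a (case_nat x q)"
  using assms by (auto simp: confined_walk_def less_Suc_eq_0_disj split: nat.splits)

lemma trapped_Suc: "trapped L (Suc n) a \<subseteq> forced L (a 0) (trapped L n (\<lambda>k. a (Suc k)))"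
proof
  fix x assume x: "x \<in> trapped L (Suc n) a"
  then have xL: "x \<in> {0..L}" by (simp add: trapped_def)
  have "y \<in> trapped L n (\<lambda>k. a (Suc k))" if y: "y \<in> {0..L}" "\<bar>y - x\<bar> = a 0" for y
  proof (rule ccontr)
    assume "y \<notin> trapped L n (\<lambda>k. a (Suc k))"
    then obtain q where "q 0 = y" "confined_walk L n (\<lambda>k. a (Suc k)) q"
      using y unfolding trapped_def by blast
    then have "confined_walk L (Suc n) a (case_nat x q)"
      using y xL by (intro confined_walk_Cons) auto
    then show False using x by (auto simp: trapped_def dest!: spec[of _ "case_nat x q"])
  qed
  with xL show "x \<in> forced L (a 0) (trapped L n (\<lambda>k. a (Suc k)))"
    by (simp add: forced_def)
qed

lemma forced_mono: "B \<subseteq> C \<Longrightarrow> forced L a B \<subseteq> forced L a C"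
  by (auto simp: forced_def)

section \<open>Sign choices for one or two steps\<close>

lemma forced_half:
  assumes "0 \<le> c" "c \<le> L / 2"
  shows "forced L c B \<subseteq> (+) c ` B \<union> (+) (- c) ` B"
proof
  fix x assume x: "x \<in> forced L c B"
  show "x \<in> (+) c ` B \<union> (+) (- c) ` B"
  proof (cases "c \<le> x")
    case True
    then have "x - c \<in> B" using x assms by (auto simp: forced_def)
    then show ?thesis by (auto intro: image_eqI[of _ _ "x - c"])
  next
    case False
    then have "x + c \<in> B" using x assms by (auto simp: forced_def)
    then show ?thesis by (auto intro: image_eqI[of _ _ "x + c"])
  qed
qed

text \<open>Every point has at most one legal move, and points strictly between \<open>L - a\<close>
  and \<open>a\<close> have none. Since \<open>L - a < a\<close>, the two pieces of \<open>B\<close>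
  are disjoint, so only the middle interval adds measure.\<close>

lemma forced_long:
  assumes "L / 2 < a"
  shows "forced L a B \<subseteq> {L - a..a} \<union> ((+) a ` (B \<inter> {0..L - a}) \<union> (+) (- a) ` (B \<inter> {a..L}))"
proof
  fix x assume x: "x \<in> forced L a B"
  consider "x \<in> {L - a..a}" | "x > a" | "x < L - a" by fastforce
  then show "x \<in> {L - a..a} \<union> ((+) a ` (B \<inter> {0..L - a}) \<union> (+) (- a) ` (B \<inter> {a..L}))"
  proof cases
    case 2
    then have "x - a \<in> B \<inter> {0..L - a}" using x assms by (auto simp: forced_def)
    then show ?thesis by (auto intro: image_eqI[of _ _ "x - a"])
  next
    case 3
    then have "x + a \<in> B \<inter> {a..L}" using x assms by (auto simp: forced_def)
    then show ?thesis by (auto intro: image_eqI[of _ _ "x + a"])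
  qed auto
qed

lemma forced_forcedD:
  assumes "x \<in> forced L b (forced L a B)"
    and "z \<in> {0..L}" "\<bar>z - x\<bar> = b" "y \<in> {0..L}" "\<bar>y - z\<bar> = a"
  shows "y \<in> B"
  using assms by (auto simp: forced_def)

text \<open>The step \<open>b\<close> is taken first. With opposite signs, \<open>a\<close> undoes
  part of \<open>b\<close> and cannot leave the interval, so a net move by \<open>b - a\<close> in
  one of the two directions is always legal.\<close>

lemma forced_forced_decreasing:
  assumes "0 \<le> a" "a \<le> b" "b \<le> L / 2"
  shows "forced L b (forced L a B) \<subseteq> (+) (b - a) ` B \<union> (+) (a - b) ` B"
proof
  fix x assume x: "x \<in> forced L b (forced L a B)"
  then have xL: "x \<in> {0..L}" by (simp add: forced_def)
  show "x \<in> (+) (b - a) ` B \<union> (+) (a - b) ` B"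
  proof (cases "b \<le> x")
    case True
    then have "x - b + a \<in> B" using forced_forcedD[OF x, of "x - b"] xL assms by auto
    then show ?thesis by (auto intro: image_eqI[of _ _ "x - b + a"])
  next
    case False
    then have "x + b - a \<in> B" using forced_forcedD[OF x, of "x + b"] xL assms by auto
    then show ?thesis by (auto intro: image_eqI[of _ _ "x + b - a"])
  qed
qed

text \<open>Opposite signs may now overshoot. Within \<open>a - b\<close> of an end both steps go
  inward; elsewhere the net move, of length \<open>a - b\<close>, points away from the centre, so
  that the targets of the two middle zones are disjoint.\<close>

lemma forced_forced_increasing:
  assumes "0 \<le> b" "b < a" "a \<le> L / 2"
  shows "forced L b (forced L a B) \<subseteq>
    (+) (- a - b) ` (B \<inter> {a + b..<2 * a}) \<union> (+) (a + b) ` (B \<inter> {L - 2 * a<..L - a - b}) \<union>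
    (+) (a - b) ` (B \<inter> {0..<L / 2 - (a - b)}) \<union> (+) (b - a) ` (B \<inter> {L / 2 + (a - b)..L})"
    (is "_ \<subseteq> ?R")
proof
  fix x assume x: "x \<in> forced L b (forced L a B)"
  then have xL: "x \<in> {0..L}" by (simp add: forced_def)
  consider "x < a - b" | "x > L - (a - b)" | "a - b \<le> x" "x < L / 2"
    | "L / 2 \<le> x" "x \<le> L - (a - b)" by linarith
  then show "x \<in> ?R"
  proof cases
    case 1
    then have "x + b + a \<in> B \<inter> {a + b..<2 * a}"
      using forced_forcedD[OF x, of "x + b"] xL assms by auto
    then have "x \<in> (+) (- a - b) ` (B \<inter> {a + b..<2 * a})"
      by (intro image_eqI[of _ _ "x + b + a"]) auto
    then show ?thesis by blast
  next
    case 2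
    then have "x - b - a \<in> B \<inter> {L - 2 * a<..L - a - b}"
      using forced_forcedD[OF x, of "x - b"] xL assms by auto
    then have "x \<in> (+) (a + b) ` (B \<inter> {L - 2 * a<..L - a - b})"
      by (intro image_eqI[of _ _ "x - b - a"]) auto
    then show ?thesis by blast
  next
    case 3
    then have "x + b - a \<in> B \<inter> {0..<L / 2 - (a - b)}"
      using forced_forcedD[OF x, of "x + b"] xL assms by auto
    then have "x \<in> (+) (a - b) ` (B \<inter> {0..<L / 2 - (a - b)})"
      by (intro image_eqI[of _ _ "x + b - a"]) auto
    then show ?thesis by blast
  next
    case 4
    then have "x - b + a \<in> B \<inter> {L / 2 + (a - b)..L}"
      using forced_forcedD[OF x, of "x - b"] xL assms by auto
    then have "x \<in> (+) (b - a) ` (B \<inter> {L / 2 + (a - b)..L})"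
      by (intro image_eqI[of _ _ "x - b + a"]) auto
    then show ?thesis by blast
  qed
qed

section \<open>Measure bounds for translated pieces\<close>

lemma coverable_subset: "coverable T c \<Longrightarrow> S \<subseteq> T \<Longrightarrow> c \<le> d \<Longrightarrow> coverable S d"
  unfolding coverable_def by (meson order_trans)

lemma coverable_Un:
  assumes "coverable S c" "coverable T d"
  shows "coverable (S \<union> T) (c + d)"
proof -
  obtain V W where "V \<in> lmeasurable" "S \<subseteq> V" "measure lebesgue V \<le> c"
    "W \<in> lmeasurable" "T \<subseteq> W" "measure lebesgue W \<le> d"
    using assms unfolding coverable_def by metis
  then show ?thesis
    unfolding coverable_def
    using measure_Un_le[of V lebesgue W] by (intro bexI[of _ "V \<union> W"]) (auto simp: fmeasurableD)
qed

lemma coverable_interval: "0 \<le> d \<Longrightarrow> b - a \<le> d \<Longrightarrow> coverable {a..b} d" for a b :: real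
  unfolding coverable_def by (intro bexI[of _ "{a..b}"]) auto

lemma coverable_translation: "coverable B c \<Longrightarrow> coverable ((+) t ` B) c"
  unfolding coverable_def
  by (metis image_mono measurable_translation measure_translation)

text \<open>The pieces of \<open>B\<close> are disjoint before translation, so together they cost
  only \<open>c\<close>, even if their translates overlap.\<close>

lemma coverable_translated_pieces:
  assumes B: "coverable B c" and "finite I" and disj: "disjoint_family_on Q I"
    and Q: "\<And>i. i \<in> I \<Longrightarrow> Q i \<in> sets borel"
  shows "coverable (\<Union>i\<in>I. (+) (t i) ` (B \<inter> Q i)) c"
proof -
  obtain V where V: "V \<in> lmeasurable" "B \<subseteq> V" "measure lebesgue V \<le> c"
    using B unfolding coverable_def by metis
  have VQ: "V \<inter> Q i \<in> lmeasurable" if "i \<in> I" for i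
    using V Q[OF that] by (intro fmeasurable_Int_fmeasurable) auto
  have m: "(+) (t i) ` (V \<inter> Q i) \<in> lmeasurable" if "i \<in> I" for i
    using VQ[OF that] by (rule measurable_translation)
  have "measure lebesgue (\<Union>i\<in>I. (+) (t i) ` (V \<inter> Q i))
      \<le> (\<Sum>i\<in>I. measure lebesgue ((+) (t i) ` (V \<inter> Q i)))"
    using m \<open>finite I\<close> by (intro measure_UNION_le) (auto simp: fmeasurableD)
  also have "\<dots> = (\<Sum>i\<in>I. measure lebesgue (V \<inter> Q i))"
    by (simp add: measure_translation)
  also have "\<dots> = measure lebesgue (\<Union>i\<in>I. V \<inter> Q i)"
  proof (rule measure_finite_Union[symmetric])
    show "disjoint_family_on (\<lambda>i. V \<inter> Q i) I"
      using disj by (auto simp: disjoint_family_on_def)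
    show "(\<lambda>i. V \<inter> Q i) ` I \<subseteq> sets lebesgue"
      using VQ by (blast dest: fmeasurableD)
    show "emeasure lebesgue (V \<inter> Q i) \<noteq> \<infinity>" if "i \<in> I" for i
      using fmeasurableD2[OF VQ[OF that]] by simp
  qed fact
  also have "\<dots> \<le> measure lebesgue V"
  proof (rule measure_mono_fmeasurable)
    show "(\<Union>i\<in>I. V \<inter> Q i) \<in> sets lebesgue"
      using VQ \<open>finite I\<close> by (intro sets.finite_UN) (blast dest: fmeasurableD)+
  qed (use V in auto)
  finally have "measure lebesgue (\<Union>i\<in>I. (+) (t i) ` (V \<inter> Q i)) \<le> c"
    using V by simp
  moreover have "(\<Union>i\<in>I. (+) (t i) ` (V \<inter> Q i)) \<in> lmeasurable"
    using m \<open>finite I\<close> by (intro fmeasurable.finite_UN) auto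
  ultimately show ?thesis
    unfolding coverable_def using V(2) by (intro bexI) auto
qed

lemma coverable_translated_pieces2:
  assumes "coverable B c" "P \<in> sets borel" "Q \<in> sets borel" "P \<inter> Q = {}"
  shows "coverable ((+) s ` (B \<inter> P) \<union> (+) t ` (B \<inter> Q)) c"
proof -
  have "coverable (\<Union>i\<in>{0, 1::nat}. (+) ([s, t] ! i) ` (B \<inter> [P, Q] ! i)) c"
    using assms by (intro coverable_translated_pieces) (auto simp: disjoint_family_on_def)
  then show ?thesis by simp
qed

lemma coverable_translated_pieces3:
  assumes "coverable B c" "P \<in> sets borel" "Q \<in> sets borel" "R \<in> sets borel"
    "P \<inter> Q = {}" "P \<inter> R = {}" "Q \<inter> R = {}"
  shows "coverable ((+) s ` (B \<inter> P) \<union> (+) t ` (B \<inter> Q) \<union> (+) u ` (B \<inter> R)) c"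
proof -
  have "coverable (\<Union>i\<in>{0, 1, 2::nat}. (+) ([s, t, u] ! i) ` (B \<inter> [P, Q, R] ! i)) c"
    using assms by (intro coverable_translated_pieces) (auto simp: disjoint_family_on_def)
  then show ?thesis by (simp add: Un_assoc)
qed

section \<open>Growth of the trapped set\<close>

lemma coverable_forced_half:
  assumes "coverable B c" "0 \<le> a" "a \<le> L / 2"
  shows "coverable (forced L a B) (2 * c)"
  using coverable_Un[OF coverable_translation coverable_translation, OF assms(1) assms(1)]
  by (rule coverable_subset[OF _ forced_half]) (use assms in auto)

lemma coverable_forced_long:
  assumes "coverable B c" "L / 2 < a" "2 * a - L \<le> d"
  shows "coverable (forced L a B) (c + d)"
proof (rule coverable_subset[OF _ forced_long])
  show "coverable ({L - a..a} \<union> ((+) a ` (B \<inter> {0..L - a}) \<union> (+) (- a) ` (B \<inter> {a..L}))) (d + c)"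
    using assms by (intro coverable_Un coverable_interval coverable_translated_pieces2) auto
qed (use assms in auto)

lemma coverable_forced_forced_half:
  assumes B: "coverable B c" and a: "0 \<le> a" "a \<le> L / 2" and b: "0 \<le> b" "b \<le> L / 2"
  shows "coverable (forced L b (forced L a B)) (2 * c)"
proof (cases "a \<le> b")
  case True
  show ?thesis
    using coverable_Un[OF coverable_translation coverable_translation, OF B B]
    by (rule coverable_subset[OF _ forced_forced_decreasing]) (use True assms in auto)
next
  case False
  let ?P = "{a + b..<2 * a}" and ?Q = "{L - 2 * a<..L - a - b}"
    and ?R = "{0..<L / 2 - (a - b)}" and ?S = "{L / 2 + (a - b)..L}"
  \<comment> \<open>The four pieces are sorted into two disjoint families costing \<open>c\<close>
    each; the part of \<open>?Q\<close> that meets \<open>?P\<close> goes to the second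
    family.\<close>
  have 1: "coverable ((+) (- a - b) ` (B \<inter> ?P) \<union> (+) (a + b) ` (B \<inter> (?Q - ?P))) c"
    using B by (intro coverable_translated_pieces2) auto
  \<comment> \<open>If \<open>?P\<close> and \<open>?Q\<close> overlap then \<open>a > L / 4\<close>, and the overlap misses \<open>?R\<close> and \<open>?S\<close>;
    so no point lies in three of the four pieces.\<close>
  have 2: "coverable ((+) (a + b) ` (B \<inter> (?Q \<inter> ?P)) \<union> (+) (a - b) ` (B \<inter> ?R)
      \<union> (+) (b - a) ` (B \<inter> ?S)) c"
    using B False by (intro coverable_translated_pieces3) auto
  have "forced L b (forced L a B) \<subseteq> (+) (- a - b) ` (B \<inter> ?P) \<union> (+) (a + b) ` (B \<inter> ?Q) \<union>
      (+) (a - b) ` (B \<inter> ?R) \<union> (+) (b - a) ` (B \<inter> ?S)"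
    using assms False by (intro forced_forced_increasing) auto
  also have "\<dots> \<subseteq> ((+) (- a - b) ` (B \<inter> ?P) \<union> (+) (a + b) ` (B \<inter> (?Q - ?P))) \<union>
      ((+) (a + b) ` (B \<inter> (?Q \<inter> ?P)) \<union> (+) (a - b) ` (B \<inter> ?R) \<union> (+) (b - a) ` (B \<inter> ?S))"
    by blast
  finally show ?thesis
    by (rule coverable_subset[OF coverable_Un[OF 1 2]]) simp
qed

text \<open>A long step adds \<open>d\<close> and one or two short steps double. The worst order is
  a short \<open>b\<close> before a long \<open>a\<close>, which gives
  \<open>2 * (c + d)\<close>.\<close>

lemma coverable_forced_forced:
  assumes B: "coverable B c" and "0 \<le> c" "0 \<le> d"
    and a: "0 \<le> a" "2 * a \<le> L + d" and b: "0 \<le> b" "2 * b \<le> L + d"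
  shows "coverable (forced L b (forced L a B)) (2 * c + 2 * d)"
proof (cases "a \<le> L / 2")
  case True
  show ?thesis
  proof (cases "b \<le> L / 2")
    case True
    then show ?thesis
      using coverable_forced_forced_half[OF B a(1) \<open>a \<le> L / 2\<close> b(1)] \<open>0 \<le> d\<close>
      by (auto elim!: coverable_subset)
  next
    case False
    then have "coverable (forced L b (forced L a B)) (2 * c + d)"
      using coverable_forced_long[OF coverable_forced_half[OF B a(1) True]] b by auto
    then show ?thesis using \<open>0 \<le> d\<close> by (auto elim!: coverable_subset)
  qed
next
  case False
  then have *: "coverable (forced L a B) (c + d)"
    using coverable_forced_long[OF B] a by auto
  show ?thesis
  proof (cases "b \<le> L / 2")
    case True
    then show ?thesis using coverable_forced_half[OF * b(1)] by (simp add: algebra_simps)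
  next
    case False
    then have "coverable (forced L b (forced L a B)) (c + d + d)"
      using coverable_forced_long[OF *, of L b d] b by auto
    then show ?thesis using \<open>0 \<le> c\<close> by (auto elim!: coverable_subset)
  qed
qed

text \<open>The bound solves the recurrence \<open>c' = 2 * c + 2 * d\<close> starting from
  \<open>0\<close>.\<close>

lemma coverable_trapped:
  assumes "0 \<le> d" "\<And>k. k < 2 * j \<Longrightarrow> 0 \<le> a k \<and> 2 * a k \<le> L + d"
  shows "coverable (trapped L (2 * j) a) ((2 ^ (j + 1) - 2) * d)"
  using assms(2)
proof (induction j arbitrary: a)
  case 0
  show ?case unfolding coverable_def by (intro bexI[of _ "{}"]) (simp_all add: trapped_0)
next
  case (Suc j)
  let ?B = "trapped L (2 * j) (\<lambda>k. a (Suc (Suc k)))"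
  have "coverable ?B ((2 ^ (j + 1) - 2) * d)"
    using Suc.prems by (intro Suc.IH) auto
  moreover have "(0::real) \<le> (2 ^ (j + 1) - 2) * d"
    using \<open>0 \<le> d\<close> by simp
  ultimately have "coverable (forced L (a 0) (forced L (a 1) ?B))
      (2 * ((2 ^ (j + 1) - 2) * d) + 2 * d)"
    using Suc.prems \<open>0 \<le> d\<close> by (intro coverable_forced_forced) auto
  moreover have "trapped L (2 * Suc j) a \<subseteq> forced L (a 0) (forced L (a 1) ?B)"
    using trapped_Suc[of L "Suc (2 * j)" a]
      forced_mono[OF trapped_Suc[of L "2 * j" "\<lambda>k. a (Suc k)"]] by fastforce
  ultimately show ?case
    by (elim coverable_subset) (auto simp: algebra_simps)
qed

section \<open>From trapped sets to signs\<close>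

lemma exists_confined_walk:
  assumes "0 \<le> d" "2 * (2 ^ (j + 1) - 2) * d < L"
    and a: "\<And>k. k < 4 * j \<Longrightarrow> 0 \<le> a k \<and> 2 * a k \<le> L + d"
  obtains p where "confined_walk L (4 * j) a p"
proof -
  \<comment> \<open>\<open>b\<close> lists the first half of the steps backwards, \<open>c\<close>
    the second half forwards.\<close>
  define b where "b k = a (2 * j - Suc k)" for k
  define c where "c k = a (2 * j + k)" for k
  have "coverable (trapped L (2 * j) b \<union> trapped L (2 * j) c)
      ((2 ^ (j + 1) - 2) * d + (2 ^ (j + 1) - 2) * d)"
    using assms by (intro coverable_Un coverable_trapped) (auto simp: b_def c_def)
  then obtain V where V: "V \<in> lmeasurable" "trapped L (2 * j) b \<union> trapped L (2 * j) c \<subseteq> V"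
    "measure lebesgue V \<le> 2 * (2 ^ (j + 1) - 2) * d"
    unfolding coverable_def by (auto simp: algebra_simps)
  have "0 \<le> 2 * (2 ^ (j + 1) - 2) * d" using \<open>0 \<le> d\<close> by simp
  then have "0 \<le> L" using assms(2) by linarith
  have "\<not> {0..L} \<subseteq> V"
  proof
    assume "{0..L} \<subseteq> V"
    then have "measure lebesgue {0..L} \<le> measure lebesgue V"
      using V(1) by (intro measure_mono_fmeasurable) auto
    then show False using V(3) assms(2) \<open>0 \<le> L\<close> by simp
  qed
  then obtain x where "x \<in> {0..L}" "x \<notin> V" by blast
  then obtain q r where q: "q 0 = x" "confined_walk L (2 * j) b q"
    and r: "r 0 = x" "confined_walk L (2 * j) c r"
    using V(2) unfolding trapped_def by blast
  define p where "p k = (if k \<le> 2 * j then q (2 * j - k) else r (k - 2 * j))" for k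
  have "\<bar>p (Suc k) - p k\<bar> = a k" if k: "k < 4 * j" for k
  proof (cases "k < 2 * j")
    case True
    let ?i = "2 * j - Suc k"
    have "\<bar>q (Suc ?i) - q ?i\<bar> = b ?i"
      using q(2) True by (auto simp: confined_walk_def)
    moreover have "Suc ?i = 2 * j - k" "b ?i = a k" using True by (auto simp: b_def)
    ultimately show ?thesis using True by (simp add: p_def abs_minus_commute)
  next
    case False
    \<comment> \<open>At the junction \<open>k = 2 * j\<close> the definition of \<open>p\<close>
      uses \<open>q 0\<close>, which equals \<open>r 0\<close>.\<close>
    then have p: "p (Suc k) = r (Suc (k - 2 * j))" "p k = r (k - 2 * j)"
      using q(1) r(1) by (auto simp: p_def Suc_diff_le)
    have "\<bar>r (Suc (k - 2 * j)) - r (k - 2 * j)\<bar> = c (k - 2 * j)"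
      using r(2) k False by (auto simp: confined_walk_def)
    then show ?thesis using False by (simp add: p c_def)
  qed
  moreover have "p k \<in> {0..L}" if "k \<le> 4 * j" for k
    using that q(2) r(2) by (auto simp: p_def confined_walk_def)
  ultimately have "confined_walk L (4 * j) a p" by (simp add: confined_walk_def)
  then show thesis by (rule that)
qed

text \<open>The signed sums are the walk shifted by \<open>- p 0\<close>, and the range ignores
  shifts. The \<open>Suc\<close> reconciles steps counted from 0 with signs counted from 1.\<close>

lemma confined_walk_signs:
  assumes "confined_walk L n (\<lambda>k. a (Suc k)) p"
  obtains e where "e \<in> {1..n} \<rightarrow> {-1, 1}" "walk_range n e a \<le> L"
proof
  define e where "e k = (if p (k - 1) \<le> p k then 1 else - 1 :: real)" for k
  show "e \<in> {1..n} \<rightarrow> {-1, 1}" by (auto simp: e_def)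
  have step: "e (Suc k) * a (Suc k) = p (Suc k) - p k" if "k < n" for k
  proof -
    have "\<bar>p (Suc k) - p k\<bar> = a (Suc k)" using assms that by (simp add: confined_walk_def)
    then show ?thesis by (auto simp: e_def abs_if split: if_splits)
  qed
  have sum: "signed_sum e a i = p i - p 0" if "i \<le> n" for i
    using that
  proof (induction i)
    case (Suc i)
    then have "signed_sum e a (Suc i) = signed_sum e a i + e (Suc i) * a (Suc i)"
      by (simp add: signed_sum_def)
    also have "\<dots> = p i - p 0 + (p (Suc i) - p i)"
      using Suc step[of i] by simp
    finally show ?case by simp
  qed (simp add: signed_sum_def)
  have "signed_sum e a ` {0..n} \<subseteq> {- p 0..L - p 0}"
  proof (rule image_subsetI)
    fix i assume "i \<in> {0..n}"
    then show "signed_sum e a i \<in> {- p 0..L - p 0}"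
      using sum[of i] assms by (auto simp: confined_walk_def)
  qed
  then have "Max (signed_sum e a ` {0..n}) \<le> L - p 0" "Min (signed_sum e a ` {0..n}) \<ge> - p 0"
    by auto
  then show "walk_range n e a \<le> L" unfolding walk_range_def by linarith
qed

lemma exists_signs:
  fixes m :: nat
  assumes "m > 0" "a \<in> {1..4 * m} \<rightarrow> {0..1}"
  obtains e where "e \<in> {1..4 * m} \<rightarrow> {-1, 1}"
    "walk_range (4 * m) e a \<le> 2 - 1 / (2 ^ (m + 3) - 7)"
proof -
  define d :: real where "d = 1 / (2 ^ (m + 3) - 7)"
  have "(2::real) ^ 1 \<le> 2 ^ m" using \<open>m > 0\<close> by (intro power_increasing) auto
  then have pos: "(2::real) ^ m \<ge> 2" by simp
  then have d: "0 < d" "(8 * 2 ^ m - 7) * d = 1"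
    by (auto simp: d_def power_add field_simps)
  \<comment> \<open>With \<open>(8 * 2 ^ m - 7) * d = 1\<close> this gives
    \<open>d \<le> 1 / 9\<close>, while the next inequality amounts to
    \<open>(1 + d) / 2 < 2\<close>.\<close>
  have "2 * d \<le> 2 ^ m * d" using pos d(1) by (intro mult_right_mono) auto
  then have "2 * (2 ^ (m + 1) - 2) * d < 2 - d"
    using d(2) by (simp add: algebra_simps)
  \<comment> \<open>For \<open>L = 2 - d\<close> the length condition
    \<open>2 * a k \<le> L + d\<close> just says that steps are at most 1.\<close>
  moreover have "0 \<le> a (Suc k) \<and> 2 * a (Suc k) \<le> 2 - d + d" if "k < 4 * m" for k
  proof -
    have "Suc k \<in> {1..4 * m}" using that by simp
    then have "a (Suc k) \<in> {0..1}" using assms(2) by blast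
    then show ?thesis by simp
  qed
  ultimately obtain p where "confined_walk (2 - d) (4 * m) (\<lambda>k. a (Suc k)) p"
    using exists_confined_walk[of d m "2 - d" "\<lambda>k. a (Suc k)"] d(1) by auto
  then show thesis
    using that by (auto simp: d_def elim: confined_walk_signs)
qed

theorem theorem1:
  fixes m n :: nat
  assumes "m > 0" and "n = 4 * m"
  shows "fit n \<le> 2 - 1 / (2 ^ (m + 3) - 7) \<and>
    (\<forall>a \<in> {1..n} \<rightarrow> {0..1}. \<exists>e \<in> {1..n} \<rightarrow> {-1, 1}.
       Max ((\<lambda>i. \<Sum>k=1..i. e k * a k) ` {0..n}) - Min ((\<lambda>i. \<Sum>k=1..i. e k * a k) ` {0..n})
         \<le> (2 - 1 / (2 ^ (m + 3) - 7) :: real))"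
proof
  have signs: "\<exists>e \<in> {1..n} \<rightarrow> {-1, 1}. walk_range n e a \<le> 2 - 1 / (2 ^ (m + 3) - 7)"
    if "a \<in> {1..n} \<rightarrow> {0..1}" for a
    using exists_signs[OF assms(1), of a] that assms(2) by metis
  then show "\<forall>a \<in> {1..n} \<rightarrow> {0..1}. \<exists>e \<in> {1..n} \<rightarrow> {-1, 1}.
       Max ((\<lambda>i. \<Sum>k=1..i. e k * a k) ` {0..n}) - Min ((\<lambda>i. \<Sum>k=1..i. e k * a k) ` {0..n})
         \<le> (2 - 1 / (2 ^ (m + 3) - 7) :: real)"
    unfolding walk_range_def signed_sum_def by blast
  obtain a where a: "a \<in> {1..n} \<rightarrow>\<^sub>E {0..1}" "step_cover n a = fit n"
    using fit_attained by blast
  then obtain e where e: "e \<in> {1..n} \<rightarrow> {-1, 1}"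
    "walk_range n e a \<le> 2 - 1 / (2 ^ (m + 3) - 7)"
    using signs[of a] by (auto simp: PiE_def simp del: One_nat_def)
  \<comment> \<open>The minimum in \<open>step_cover\<close> ranges over extensional sign functions;
    restricting \<open>e\<close> leaves the signed sums up to \<open>n\<close> unchanged.\<close>
  let ?e = "restrict e {1..n}"
  have "signed_sum ?e a ` {0..n} = signed_sum e a ` {0..n}"
    unfolding signed_sum_def by (intro image_cong sum.cong refl) auto
  then have "walk_range n ?e a = walk_range n e a"
    by (simp add: walk_range_def)
  moreover have "step_cover n a \<le> walk_range n ?e a"
    unfolding step_cover_def
    using e(1) finite_signs by (intro Min_le finite_imageI imageI) auto
  ultimately show "fit n \<le> 2 - 1 / (2 ^ (m + 3) - 7)"
    using a(2) e(2) by simp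
qed

end
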